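(* Satisfaction Approval Voting ($\mathit{SAV}$) and Minimax Approval Voting ($\mathit{MAV}$) do not satisfy JR for $k\ge 2$: for every $k\ge 2$ and for each rule $\mathcal{R}\in\{\mathit{SAV},\mathit{MAV}\}$ there exist a candidate set $C$ and a ballot profile $\vec{A}$ over $C$ such that the committee output by $\mathcal{R}$ on $(\vec{A},k)$ (whatever the tie-breaking rule) does not provide justified representation for $(\vec{A},k)$.
   Context: Setting. $N=\{1,\dots,n\}$ ($n\ge 1$) is a set of voters, $C$ is a finite set of candidates. Each voter $i\in N$ submits an approval ballot $A_i\subseteq C$; the list $\vec{A}=(A_1,\dots,A_n)$ is the ballot profile. An approval-based multi-winner rule takes $(N,C,\vec{A},k)$ with $1\le k\le|C|$ and returns a committee $W\subseteq C$ with $|W|=k$; ties are broken by some deterministic procedure. Justified representation (JR). A set $W\subseteq C$ with $|W|=k$ provides justified representation for $(\vec{A},k)$ if there is no set of voters $N^*\subseteq N$ with $|N^*|\ge \frac{n}{k}$ such that $\bigcap_{i\in N^*}A_i\neq\emptyset$ and $A_i\cap W=\emptyset$ for all $i\in N^*$. $\mathit{SAV}$ outputs a set $W\subseteq C$ of size $k$ that maximizes $\sum_{i\in N}\frac{|W\cap A_i|}{|A_i|}$ (a voter with an empty ballot contributes $0$). $\mathit{MAV}$: let $d(Q,T)=|Q\setminus T|+|T\setminus Q|$ be the Hamming distance. The $\mathit{MAV}$-score of $W\subseteq C$ is $\max(d(W,A_1),\dots,d(W,A_n))$, and $\mathit{MAV}$ outputs a size-$k$ set with the lowest $\mathit{MAV}$-score.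 *)

theory Defs
  imports Complex_Main
begin

(* The profile (A_1,...,A_n) is the list A; voters are its positions 0,...,n-1 with n = length A. *)

definition election :: "'c set \<Rightarrow> 'c set list \<Rightarrow> nat \<Rightarrow> bool" where
  "election C A k \<longleftrightarrow>
     finite C \<and> A \<noteq> [] \<and> (\<forall>i < length A. A ! i \<subseteq> C) \<and> 1 \<le> k \<and> k \<le> card C"

definition committee :: "'c set \<Rightarrow> nat \<Rightarrow> 'c set \<Rightarrow> bool" where
  "committee C k W \<longleftrightarrow> W \<subseteq> C \<and> card W = k"

definition provides_JR :: "'c set list \<Rightarrow> nat \<Rightarrow> 'c set \<Rightarrow> bool" where
  "provides_JR A k W \<longleftrightarrow>
     \<not> (\<exists>S \<subseteq> {..<length A}.
          real (card S) \<ge> real (length A) / real k \<and>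
          (\<Inter>i\<in>S. A ! i) \<noteq> {} \<and>
          (\<forall>i\<in>S. A ! i \<inter> W = {}))"

(* An empty ballot contributes 0, since x / 0 = 0. *)
definition sav_score :: "'c set list \<Rightarrow> 'c set \<Rightarrow> real" where
  "sav_score A W = (\<Sum>i<length A. real (card (W \<inter> A ! i)) / real (card (A ! i)))"

definition hamming :: "'c set \<Rightarrow> 'c set \<Rightarrow> nat" where
  "hamming Q T = card (Q - T) + card (T - Q)"

definition mav_score :: "'c set list \<Rightarrow> 'c set \<Rightarrow> nat" where
  "mav_score A W = Max ((\<lambda>i. hamming W (A ! i)) ` {..<length A})"

(* A rule maps C, A, k to one committee. The predicates SAV_rule and MAV_rule hold of exactly
   the rules arising from SAV and MAV by some deterministic tie-breaking; the tie-breaking may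
   depend on the whole election. *)
type_synonym 'c rule = "'c set \<Rightarrow> 'c set list \<Rightarrow> nat \<Rightarrow> 'c set"

definition SAV_rule :: "'c rule \<Rightarrow> bool" where
  "SAV_rule R \<longleftrightarrow>
     (\<forall>C A k. election C A k \<longrightarrow> is_arg_max (sav_score A) (committee C k) (R C A k))"

definition MAV_rule :: "'c rule \<Rightarrow> bool" where
  "MAV_rule R \<longleftrightarrow>
     (\<forall>C A k. election C A k \<longrightarrow> is_arg_min (mav_score A) (committee C k) (R C A k))"

lemma finite_committees: "finite C \<Longrightarrow> finite {W. committee C k W}"
  by (rule finite_subset[of _ "Pow C"]) (auto simp: committee_def)

lemma committee_exists: "election C A k \<Longrightarrow> {W. committee C k W} \<noteq> {}"
  unfolding election_def committee_def
  by (metis (mono_tags, lifting) empty_iff mem_Collect_eq obtain_subset_with_card_n)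

lemma ex_SAV_rule: "\<exists>R :: 'c rule. SAV_rule R"
proof -
  have "\<exists>W. is_arg_max (sav_score A) (committee C k) W"
    if e: "election C A k" for C :: "'c set" and A k
  proof -
    have "finite {W. committee C k W}"
      using e finite_committees by (auto simp: election_def)
    from arg_min_if_finite[OF this committee_exists[OF e], of "\<lambda>W. - sav_score A W"]
    show ?thesis unfolding is_arg_max_def
      by (intro exI[of _ "arg_min_on (\<lambda>W. - sav_score A W) {W. committee C k W}"]) auto
  qed
  then have "SAV_rule (\<lambda>C A k. SOME W :: 'c set. is_arg_max (sav_score A) (committee C k) W)"
    unfolding SAV_rule_def by (intro allI impI) (rule someI_ex)
  then show ?thesis by (rule exI[of SAV_rule])
qed

lemma ex_MAV_rule: "\<exists>R :: 'c rule. MAV_rule R"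
proof -
  have "\<exists>W. is_arg_min (mav_score A) (committee C k) W"
    if e: "election C A k" for C :: "'c set" and A k
  proof -
    have "finite {W. committee C k W}"
      using e finite_committees by (auto simp: election_def)
    from arg_min_if_finite[OF this committee_exists[OF e], of "mav_score A"]
    show ?thesis unfolding is_arg_min_def
      by (intro exI[of _ "arg_min_on (mav_score A) {W. committee C k W}"]) auto
  qed
  then have "MAV_rule (\<lambda>C A k. SOME W :: 'c set. is_arg_min (mav_score A) (committee C k) W)"
    unfolding MAV_rule_def by (intro allI impI) (rule someI_ex)
  then show ?thesis by (rule exI[of MAV_rule])
qed

end

theory Submission
  imports Defs
begin

text \<open>Both counterexamples use \<open>k\<close> voters: one approves a set \<open>X\<close>, all others approve a set \<open>Y\<close>
  disjoint from \<open>X\<close> with at least \<open>k\<close> members. As \<open>n / k = 1\<close>, the first voter alone is entitled to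
  a representative, so JR fails once the rule must choose its committee inside \<open>Y\<close>.
  For SAV it suffices that \<open>X\<close> is larger than \<open>Y\<close>: a candidate in \<open>X\<close> contributes only
  \<open>1 / card X\<close>. For MAV, take \<open>X\<close> a singleton and \<open>card Y = 2 * k\<close>, so that the distance to \<open>Y\<close>
  decides the score of every committee that meets \<open>X\<close>.\<close>

definition lone_profile :: "nat \<Rightarrow> 'c set \<Rightarrow> 'c set \<Rightarrow> 'c set list" where
  "lone_profile k X Y = X # replicate (k - 1) Y"

lemma election_lone_profile:
  assumes "finite X" "finite Y" "1 \<le> k" "k \<le> card Y"
  shows "election (X \<union> Y) (lone_profile k X Y) k"
proof -
  have "card Y \<le> card (X \<union> Y)"
    using assms by (intro card_mono) auto
  then show ?thesis
    using assms by (auto simp: election_def lone_profile_def nth_Cons split: nat.splits)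
qed

lemma lone_voter_unrepresented:
  assumes "1 \<le> k" "X \<noteq> {}" "X \<inter> W = {}"
  shows "\<not> provides_JR (lone_profile k X Y) k W"
  unfolding provides_JR_def not_not
  \<comment> \<open>Position \<open>0\<close> holds the ballot \<open>X\<close>, and
    \<open>1 \<le> k\<close> makes the length \<open>1 + (k - 1)\<close> equal to
    \<open>k\<close>.\<close>
  using assms by (intro exI[of _ "{0}"]) (auto simp: lone_profile_def)

lemma sav_score_lone_profile:
  "sav_score (lone_profile k X Y) W =
     card (W \<inter> X) / card X + real (k - 1) * (card (W \<inter> Y) / card Y)"
  by (simp add: sav_score_def lone_profile_def sum.lessThan_Suc_shift del: sum.lessThan_Suc)

text \<open>A voter with ballot \<open>Y\<close> exists only from \<open>k = 2\<close> on; for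
  \<open>k = 1\<close> the distance to \<open>X\<close> alone would count.\<close>

lemma mav_score_lone_profile:
  assumes "k \<ge> 2"
  shows "mav_score (lone_profile k X Y) W = max (hamming W X) (hamming W Y)"
proof -
  have "(\<lambda>i. hamming W (lone_profile k X Y ! i)) ` {..<length (lone_profile k X Y)}
      = hamming W ` set (lone_profile k X Y)"
    by (force simp: set_conv_nth)
  then show ?thesis
    using assms by (simp add: mav_score_def lone_profile_def)
qed

lemma card_committee_split:
  assumes "committee (X \<union> Y) k W" "finite X" "finite Y" "X \<inter> Y = {}"
  shows "card (W \<inter> X) + card (W \<inter> Y) = k"
proof -
  have "W = (W \<inter> X) \<union> (W \<inter> Y)"
    using assms by (auto simp: committee_def)
  then have "card W = card (W \<inter> X) + card (W \<inter> Y)"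
    using assms by (metis card_Un_disjoint finite_Int inf_assoc inf_bot_right inf_left_commute)
  then show ?thesis
    using assms by (simp add: committee_def)
qed

text \<open>Trading a member of \<open>X\<close> for one of \<open>Y\<close> loses
  \<open>1 / (k + 1)\<close> and gains \<open>(k - 1) / k\<close>, which is more for
  \<open>k \<ge> 2\<close>. With \<open>card X = k\<close> the two would tie at
  \<open>k = 2\<close>. Since \<open>card Y = k\<close>, the committee to compare with is
  \<open>Y\<close> itself.\<close>

lemma SAV_avoids_lone_ballot:
  assumes k: "k \<ge> 2" and fin: "finite X" "finite Y" and disj: "X \<inter> Y = {}"
    and Y: "card Y = k" and X: "card X = k + 1"
    and max: "is_arg_max (sav_score (lone_profile k X Y)) (committee (X \<union> Y) k) W"
  shows "X \<inter> W = {}"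
proof (rule ccontr)
  assume "X \<inter> W \<noteq> {}"
  define a where "a = real (card (W \<inter> X))"
  have a: "a > 0"
    using \<open>X \<inter> W \<noteq> {}\<close> fin by (auto simp: a_def card_gt_0_iff)
  have W: "committee (X \<union> Y) k W"
    using max by (simp add: is_arg_max_def)
  have b: "real (card (W \<inter> Y)) = k - a"
    using card_committee_split[OF W fin disj] by (simp add: a_def)
  have "committee (X \<union> Y) k Y"
    using Y by (auto simp: committee_def)
  then have "sav_score (lone_profile k X Y) Y \<le> sav_score (lone_profile k X Y) W"
    using max by (meson is_arg_max_def not_le_imp_less)
  \<comment> \<open>The left side is the score of \<open>Y\<close>: it fully satisfies
    \<open>k - 1\<close> voters and gives the first one nothing.\<close>
  then have "real k - 1 \<le> a / (real k + 1) + (real k - 1) * ((k - a) / k)"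
    using k disj by (simp add: sav_score_lone_profile X Y b a_def Int_commute of_nat_diff add.commute)
  also have "(real k - 1) * ((k - a) / k) = real k - 1 - a * (real k - 1) / k"
    using k by (simp add: field_simps)
  finally have "a * (real k - 1) / k \<le> a / (real k + 1)"
    by (simp only: add_diff_eq le_diff_eq)
  then have "a * ((real k - 1) * (real k + 1)) \<le> a * k"
    using k by (simp add: divide_le_eq pos_le_divide_eq mult.assoc)
  then have "(real k - 1) * (real k + 1) \<le> k"
    using a by simp
  \<comment> \<open>Then \<open>k * k - 1\<close> is at least \<open>2 * k - 1\<close>, which
    exceeds \<open>k\<close>.\<close>
  moreover have "2 * real k \<le> real k * real k"
    using k by (intro mult_right_mono) auto
  ultimately show False
    using k by (simp add: algebra_simps)
qed

text \<open>A committee containing \<open>x\<close> is at distance \<open>k + 2\<close> from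
  \<open>Y\<close>, whereas one inside \<open>Y\<close> has distances \<open>k\<close> to
  \<open>Y\<close> and \<open>k + 1\<close> to \<open>{x}\<close>. The size \<open>2 * k\<close> is
  the least that makes this comparison strict.\<close>

lemma MAV_avoids_lone_ballot:
  assumes k: "k \<ge> 2" and fin: "finite Y" and x: "x \<notin> Y" and Y: "card Y = 2 * k"
    and min: "is_arg_min (mav_score (lone_profile k {x} Y)) (committee ({x} \<union> Y) k) W"
  shows "{x} \<inter> W = {}"
proof (rule ccontr)
  assume "{x} \<inter> W \<noteq> {}"
  then have xW: "W \<inter> {x} = {x}" by auto
  have W: "committee ({x} \<union> Y) k W"
    using min by (simp add: is_arg_min_def)
  then have finW: "finite W"
    using fin by (auto simp: committee_def intro: finite_subset)
  have "card (W \<inter> Y) = k - 1"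
    using card_committee_split[OF W] fin x xW by simp
  then have "card (W - Y) = 1" "card (Y - W) = k + 1"
    using W Y k fin finW card_Diff_subset_Int[of W Y] card_Diff_subset_Int[of Y W]
    by (simp_all add: committee_def Int_commute)
  then have "hamming W Y = k + 2"
    by (simp add: hamming_def)
  then have score_W: "mav_score (lone_profile k {x} Y) W \<ge> k + 2"
    using k by (simp add: mav_score_lone_profile)
  obtain V where V: "V \<subseteq> Y" "card V = k" "finite V"
    using obtain_subset_with_card_n[of k Y] Y by auto
  then have "V - {x} = V" "{x} - V = {x}" "V - Y = {}"
    using x by auto
  then have "hamming V {x} = k + 1" "hamming V Y = k"
    using V Y by (simp_all add: hamming_def card_Diff_subset)
  then have "mav_score (lone_profile k {x} Y) V = k + 1"
    using k by (simp add: mav_score_lone_profile)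
  moreover have "committee ({x} \<union> Y) k V"
    using V by (auto simp: committee_def)
  ultimately show False
    using min score_W by (auto simp: is_arg_min_def)
qed

theorem theorem4:
  fixes k :: nat
  assumes "k \<ge> 2"
  shows "(\<exists>(C :: nat set) A. election C A k \<and>
            (\<forall>R. SAV_rule R \<longrightarrow> \<not> provides_JR A k (R C A k))) \<and>
         (\<exists>(C :: nat set) A. election C A k \<and>
            (\<forall>R. MAV_rule R \<longrightarrow> \<not> provides_JR A k (R C A k)))"
proof (intro conjI)
  \<comment> \<open>\<open>{..k}\<close> includes \<open>0\<close> and so has \<open>k + 1\<close>
    members.\<close>
  let ?X = "{..k}" and ?Y = "{k<..2 * k}"
  let ?A = "lone_profile k ?X ?Y"
  have e: "election (?X \<union> ?Y) ?A k"
    using assms by (intro election_lone_profile) auto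
  moreover have "\<not> provides_JR ?A k (R (?X \<union> ?Y) ?A k)" if "SAV_rule R" for R
  proof (rule lone_voter_unrepresented)
    have "is_arg_max (sav_score ?A) (committee (?X \<union> ?Y) k) (R (?X \<union> ?Y) ?A k)"
      using that e unfolding SAV_rule_def by blast
    then show "?X \<inter> R (?X \<union> ?Y) ?A k = {}"
      by (rule SAV_avoids_lone_ballot[rotated -1]) (use assms in auto)
  qed (use assms in auto)
  ultimately show "\<exists>(C :: nat set) A. election C A k \<and>
      (\<forall>R. SAV_rule R \<longrightarrow> \<not> provides_JR A k (R C A k))"
    by blast
next
  let ?Y = "{0<..2 * k}"
  let ?A = "lone_profile k {0} ?Y"
  have e: "election ({0} \<union> ?Y) ?A k"
    using assms by (intro election_lone_profile) auto
  moreover have "\<not> provides_JR ?A k (R ({0} \<union> ?Y) ?A k)" if "MAV_rule R" for R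
  proof (rule lone_voter_unrepresented)
    have "is_arg_min (mav_score ?A) (committee ({0} \<union> ?Y) k) (R ({0} \<union> ?Y) ?A k)"
      using that e unfolding MAV_rule_def by blast
    then show "{0} \<inter> R ({0} \<union> ?Y) ?A k = {}"
      by (rule MAV_avoids_lone_ballot[rotated -1]) (use assms in auto)
  qed (use assms in auto)
  ultimately show "\<exists>(C :: nat set) A. election C A k \<and>
      (\<forall>R. MAV_rule R \<longrightarrow> \<not> provides_JR A k (R C A k))"
    by blast
qed

end
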